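(* Let $R$ be a local domain, let $x_1,\ldots,x_k$ be part of a system of parameters for $R$, and let $\mathrm{cl}$ be a closure operation on $R$ such that $(x_1\cdots x_k)^t\in (x_1^{t+1},x_2^{t+1},\ldots,x_k^{t+1})^{\mathrm{cl}}$ for some integer $t\ge 0$. Then $\mathrm{cl}$ is not a Dietz closure.
   Context: Local rings are commutative Noetherian. A closure operation $\mathrm{cl}$ on a ring $R$ assigns to each pair $N\subseteq M$ of finitely generated $R$-modules a submodule $N_M^{\mathrm{cl}}$ of $M$ such that, for $N\subseteq N'\subseteq M$: $N\subseteq N_M^{\mathrm{cl}}$; $(N_M^{\mathrm{cl}})_M^{\mathrm{cl}}=N_M^{\mathrm{cl}}$; $N_M^{\mathrm{cl}}\subseteq (N')_M^{\mathrm{cl}}$. For an ideal $I$ of $R$, $I^{\mathrm{cl}}$ means $I_R^{\mathrm{cl}}$. A closure operation $\mathrm{cl}$ on a local domain $(R,m)$ is a Dietz closure if, for all finitely generated $R$-modules $N\subseteq M$ and $W$: (1) (Functoriality) for every homomorphism $f:M\to W$, $f(N_M^{\mathrm{cl}})\subseteq f(N)_W^{\mathrm{cl}}$; (2) (Semi-residuality) if $N_M^{\mathrm{cl}}=N$ then $0_{M/N}^{\mathrm{cl}}=0$; (3) (Faithfulness) $m_R^{\mathrm{cl}}=m$; (4) (Generalized Colon-Capturing) if $x_1,\ldots,x_{k+1}$ ($k\ge 0$) is a partial system of parameters for $R$, $J=(x_1,\ldots,x_k)$, $f:M\to R/J$ is a surjective homomorphism and $v\in M$ satisfies $f(v)=x_{k+1}+J$,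 then $(Rv)_M^{\mathrm{cl}}\cap\ker f\subseteq (Jv)_M^{\mathrm{cl}}$. *)

theory Defs
  imports "HOL-Algebra.Module" "HOL-Algebra.QuotRing" "HOL-Algebra.Ring_Divisibility"
    "HOL-Library.Extended_Nat" "HOL-Library.Equipollence"
begin

section \<open>Local domains and systems of parameters\<close>

locale local_domain = noetherian_domain R + maximalideal m R for R (structure) and m +
  assumes maximalideal_unique: "maximalideal n R \<Longrightarrow> n = m"

definition krull_dim :: "('a, 'r) ring_scheme \<Rightarrow> enat" where
  "krull_dim R = Sup {enat n | n. \<exists>P :: nat \<Rightarrow> 'a set.
     (\<forall>i\<le>n. primeideal (P i) R) \<and> (\<forall>i<n. P i \<subset> P (Suc i))}"

definition radical :: "('a, 'r) ring_scheme \<Rightarrow> 'a set \<Rightarrow> 'a set" where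
  "radical R I = {a \<in> carrier R. \<exists>n::nat. a [^]\<^bsub>R\<^esub> n \<in> I}"

definition system_of_parameters :: "('a, 'r) ring_scheme \<Rightarrow> 'a set \<Rightarrow> 'a list \<Rightarrow> bool" where
  "system_of_parameters R m xs \<longleftrightarrow>
     set xs \<subseteq> m \<and> enat (length xs) = krull_dim R \<and> radical R (genideal R (set xs)) = m"

definition partial_sop :: "('a, 'r) ring_scheme \<Rightarrow> 'a set \<Rightarrow> 'a list \<Rightarrow> bool" where
  "partial_sop R m xs \<longleftrightarrow> (\<exists>ys. system_of_parameters R m (xs @ ys))"


section \<open>Modules\<close>

text \<open>
  The library record for modules extends the record for rings; its fields \<open>mult\<close> and \<open>one\<close>
  play no role in the module axioms and are filled arbitrarily below.
\<close>

definition fg_module :: "('a, 'r) ring_scheme \<Rightarrow> ('a, 'b) module \<Rightarrow> bool" where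
  "fg_module R M \<longleftrightarrow> Module.module R M \<and>
     (\<exists>S. finite S \<and> S \<subseteq> carrier M \<and> (\<lambda>H. submodule H R M) hull S = carrier M)"

definition mod_hom ::
  "('a, 'r) ring_scheme \<Rightarrow> ('a, 'b) module \<Rightarrow> ('a, 'c) module \<Rightarrow> ('b \<Rightarrow> 'c) set" where
  "mod_hom R M N = {f \<in> carrier M \<rightarrow> carrier N.
     (\<forall>x\<in>carrier M. \<forall>y\<in>carrier M. f (x \<oplus>\<^bsub>M\<^esub> y) = f x \<oplus>\<^bsub>N\<^esub> f y) \<and>
     (\<forall>a\<in>carrier R. \<forall>x\<in>carrier M. f (a \<odot>\<^bsub>M\<^esub> x) = a \<odot>\<^bsub>N\<^esub> f x)}"

definition mod_iso ::
  "('a, 'r) ring_scheme \<Rightarrow> ('a, 'b) module \<Rightarrow> ('a, 'c) module \<Rightarrow> ('b \<Rightarrow> 'c) set" where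
  "mod_iso R M N = {f \<in> mod_hom R M N. bij_betw f (carrier M) (carrier N)}"

definition quot_module :: "('a, 'b) module \<Rightarrow> 'b set \<Rightarrow> ('a, 'b set) module" where
  "quot_module M N = \<lparr>carrier = a_rcosets\<^bsub>M\<^esub> N, monoid.mult = undefined, one = undefined,
     ring.zero = N, add = set_add M, smult = (\<lambda>a C. \<Union>x\<in>C. N +>\<^bsub>M\<^esub> (a \<odot>\<^bsub>M\<^esub> x))\<rparr>"

definition regular_module :: "('a, 'r) ring_scheme \<Rightarrow> ('a, 'a) module" where
  "regular_module R = \<lparr>carrier = carrier R, monoid.mult = monoid.mult R, one = one R,
     ring.zero = ring.zero R, add = add R, smult = monoid.mult R\<rparr>"

text \<open>The isomorphic copy of \<open>M\<close> obtained by renaming its elements along \<open>f\<close>.\<close>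

definition transport_module :: "('b \<Rightarrow> 'c) \<Rightarrow> ('a, 'b) module \<Rightarrow> ('a, 'c) module" where
  "transport_module f M = (let g = inv_into (carrier M) f in
     \<lparr>carrier = f ` carrier M, monoid.mult = undefined, one = undefined, ring.zero = f \<zero>\<^bsub>M\<^esub>,
      add = (\<lambda>x y. f (g x \<oplus>\<^bsub>M\<^esub> g y)), smult = (\<lambda>a x. f (a \<odot>\<^bsub>M\<^esub> g x))\<rparr>)"


section \<open>Closure operations\<close>

text \<open>
  A closure operation ranges over all finitely generated modules, which HOL cannot quantify over
  at once. They are represented by the modules whose carrier lies in a fixed type \<open>'u\<close>. If \<open>'u\<close> is
  infinite and \<open>\<iota>\<close> embeds \<open>R\<close> into it, then every finitely generated \<open>R\<close>-module, over whatever type,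
  has an isomorphic copy in \<open>'u\<close> (lemma \<open>ex_copy\<close> below). The embedding \<open>\<iota>\<close> also
  provides the copy of \<open>R\<close> itself in which the closure of ideals is computed.
\<close>

definition module_universe :: "('a, 'r) ring_scheme \<Rightarrow> ('a \<Rightarrow> 'u) \<Rightarrow> bool" where
  "module_universe R \<iota> \<longleftrightarrow> infinite (UNIV :: 'u set) \<and> inj_on \<iota> (carrier R)"

lemma transport_module_iso:
  assumes "Module.module R M" and inj: "inj_on f (carrier M)"
  shows "f \<in> mod_iso R M (transport_module f M)"
    and "Module.module R (transport_module f M)"
proof -
  interpret Module.module R M by fact
  let ?T = "transport_module f M"
  have c: "carrier ?T = f ` carrier M" and z: "\<zero>\<^bsub>?T\<^esub> = f \<zero>\<^bsub>M\<^esub>"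
    by (simp_all add: transport_module_def Let_def)
  have a: "f x \<oplus>\<^bsub>?T\<^esub> f y = f (x \<oplus>\<^bsub>M\<^esub> y)" if "x \<in> carrier M" "y \<in> carrier M" for x y
    using that by (simp add: transport_module_def Let_def inj)
  have s: "r \<odot>\<^bsub>?T\<^esub> f x = f (r \<odot>\<^bsub>M\<^esub> x)" if "x \<in> carrier M" for r x
    using that by (simp add: transport_module_def Let_def inj)
  show "f \<in> mod_iso R M ?T"
    using inj by (auto simp: mod_iso_def mod_hom_def c a s bij_betw_def)
  have "abelian_group ?T"
  proof (rule abelian_groupI)
    fix x assume "x \<in> carrier ?T"
    then obtain x' where x': "x' \<in> carrier M" "x = f x'" by (auto simp: c)
    then have "f (\<ominus>\<^bsub>M\<^esub> x') \<in> carrier ?T" "f (\<ominus>\<^bsub>M\<^esub> x') \<oplus>\<^bsub>?T\<^esub> x = \<zero>\<^bsub>?T\<^esub>"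
      by (simp_all add: a z M.l_neg c)
    then show "\<exists>y\<in>carrier ?T. y \<oplus>\<^bsub>?T\<^esub> x = \<zero>\<^bsub>?T\<^esub>" by blast
  qed (auto simp: c z a M.a_ac)
  then show "Module.module R ?T"
    by (intro moduleI R.is_cring)
      (auto simp: c a s smult_l_distr smult_r_distr smult_assoc1)
qed

lemma fg_image:
  assumes M: "Module.module R M" and T: "Module.module R T" and f: "f \<in> mod_hom R M T"
    and c: "carrier T = f ` carrier M"
    and S: "finite S" "S \<subseteq> carrier M" "(\<lambda>H. submodule H R M) hull S = carrier M"
  shows "fg_module R T"
proof -
  interpret M: Module.module R M by fact
  interpret T: Module.module R T by fact
  have a: "f (x \<oplus>\<^bsub>M\<^esub> y) = f x \<oplus>\<^bsub>T\<^esub> f y" if "x \<in> carrier M" "y \<in> carrier M" for x y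
    using f that by (simp add: mod_hom_def)
  have s: "f (r \<odot>\<^bsub>M\<^esub> x) = r \<odot>\<^bsub>T\<^esub> f x" if "r \<in> carrier R" "x \<in> carrier M" for r x
    using f that by (simp add: mod_hom_def)
  have fc: "f x \<in> carrier T" if "x \<in> carrier M" for x
    using that c by simp
  have z: "f \<zero>\<^bsub>M\<^esub> = \<zero>\<^bsub>T\<^esub>"
    using s[of "\<zero>\<^bsub>R\<^esub>" "\<zero>\<^bsub>M\<^esub>"] fc by simp
  have "carrier T \<subseteq> H" if H: "submodule H R T" "f ` S \<subseteq> H" for H
  proof -
    note E = T.submoduleE[OF H(1)]
    let ?K = "{x \<in> carrier M. f x \<in> H}"
    obtain h where h: "h \<in> H" "h \<in> carrier T" using E(1,2) by blast
    then have z': "\<zero>\<^bsub>T\<^esub> \<in> H" using E(4)[of "\<zero>\<^bsub>R\<^esub>" h] by simp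
    have "submodule ?K R M"
    proof (rule M.submoduleI)
      fix x assume x: "x \<in> ?K"
      then have "\<ominus>\<^bsub>M\<^esub> x = (\<ominus>\<^bsub>R\<^esub> \<one>\<^bsub>R\<^esub>) \<odot>\<^bsub>M\<^esub> x" by (simp add: M.smult_l_minus)
      with x E(4) show "\<ominus>\<^bsub>M\<^esub> x \<in> ?K" by (simp add: s)
    next
      fix x y assume "x \<in> ?K" "y \<in> ?K"
      then show "x \<oplus>\<^bsub>M\<^esub> y \<in> ?K" using E(5) by (simp add: a)
    next
      fix r x assume "r \<in> carrier R" "x \<in> ?K"
      then show "r \<odot>\<^bsub>M\<^esub> x \<in> ?K" using E(4) by (simp add: s)
    qed (simp_all add: z z' subset_iff)
    moreover have "S \<subseteq> ?K" using S H(2) by auto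
    ultimately have "carrier M \<subseteq> ?K"
      using S(3) hull_minimal[of S ?K "\<lambda>H. submodule H R M"] by simp
    then show ?thesis by (auto simp: c)
  qed
  then have "(\<lambda>H. submodule H R T) hull (f ` S) = carrier T"
    using T.carrier_is_submodule S(2) unfolding hull_def
    by (intro equalityI Inter_lower Inter_greatest) (auto simp: c)
  with S T show ?thesis
    unfolding fg_module_def by (intro conjI exI[of _ "f ` S"]) (auto simp: c)
qed

lemma transport_module_fg:
  assumes M: "fg_module R M" and inj: "inj_on f (carrier M)"
  shows "fg_module R (transport_module f M)"
proof -
  from M obtain S where M': "Module.module R M" and S: "finite S" "S \<subseteq> carrier M"
      "(\<lambda>H. submodule H R M) hull S = carrier M"
    by (auto simp: fg_module_def)
  have "f \<in> mod_hom R M (transport_module f M)"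
    using transport_module_iso(1)[OF M' inj] by (simp add: mod_iso_def)
  then show ?thesis
    by (rule fg_image[OF M' transport_module_iso(2)[OF M' inj] _ _ S])
      (simp add: transport_module_def Let_def)
qed

lemma quot_module_fg:
  assumes M: "fg_module R M" and N: "submodule N R M"
  shows "fg_module R (quot_module M N)"
    and "(\<lambda>x. N +>\<^bsub>M\<^esub> x) \<in> mod_hom R M (quot_module M N)"
proof -
  from M interpret Module.module R M by (simp add: fg_module_def)
  interpret N: submodule N R M by fact
  interpret A: abelian_subgroup N M
    by (intro abelian_subgroupI3 additive_subgroup.intro N.subgroup_axioms abelian_group_axioms)
  let ?Q = "quot_module M N"
  let ?p = "\<lambda>x. N +>\<^bsub>M\<^esub> x"
  have c: "carrier ?Q = ?p ` carrier M"
    by (auto simp: quot_module_def A_RCOSETS_def' a_r_coset_def')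
  have z: "\<zero>\<^bsub>?Q\<^esub> = ?p \<zero>\<^bsub>M\<^esub>"
    using M.a_coset_add_zero[OF A.a_subset] by (simp add: quot_module_def)
  have a: "?p x \<oplus>\<^bsub>?Q\<^esub> ?p y = ?p (x \<oplus>\<^bsub>M\<^esub> y)" if "x \<in> carrier M" "y \<in> carrier M" for x y
    using that A.a_rcos_sum by (simp add: quot_module_def)
  have s: "r \<odot>\<^bsub>?Q\<^esub> ?p x = ?p (r \<odot>\<^bsub>M\<^esub> x)" if r: "r \<in> carrier R" and x: "x \<in> carrier M" for r x
  proof -
    have "?p (r \<odot>\<^bsub>M\<^esub> y) = ?p (r \<odot>\<^bsub>M\<^esub> x)" if "y \<in> ?p x" for y
    proof -
      from that obtain n where n: "n \<in> N" "y = n \<oplus>\<^bsub>M\<^esub> x" by (auto simp: a_r_coset_def')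
      have nM: "n \<in> carrier M" using n A.a_subset by auto
      have "r \<odot>\<^bsub>M\<^esub> y = r \<odot>\<^bsub>M\<^esub> n \<oplus>\<^bsub>M\<^esub> r \<odot>\<^bsub>M\<^esub> x" using n nM r x by (simp add: smult_r_distr)
      moreover have "r \<odot>\<^bsub>M\<^esub> n \<in> N" using r n N.smult_closed by blast
      ultimately have "r \<odot>\<^bsub>M\<^esub> y \<in> ?p (r \<odot>\<^bsub>M\<^esub> x)" by (auto simp: a_r_coset_def')
      then show ?thesis using A.a_repr_independence' r x by simp
    qed
    moreover have "x \<in> ?p x" using x A.a_rcos_self by blast
    ultimately have "(\<Union>y\<in>?p x. ?p (r \<odot>\<^bsub>M\<^esub> y)) = ?p (r \<odot>\<^bsub>M\<^esub> x)" by blast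
    then show ?thesis by (simp add: quot_module_def)
  qed
  show hom: "?p \<in> mod_hom R M ?Q" by (auto simp: mod_hom_def c a s)
  have "abelian_group ?Q"
  proof (rule abelian_groupI)
    fix x assume "x \<in> carrier ?Q"
    then obtain x' where x': "x' \<in> carrier M" "x = ?p x'" by (auto simp: c)
    then have "?p (\<ominus>\<^bsub>M\<^esub> x') \<in> carrier ?Q" "?p (\<ominus>\<^bsub>M\<^esub> x') \<oplus>\<^bsub>?Q\<^esub> x = \<zero>\<^bsub>?Q\<^esub>"
      by (simp_all add: a z M.l_neg c)
    then show "\<exists>y\<in>carrier ?Q. y \<oplus>\<^bsub>?Q\<^esub> x = \<zero>\<^bsub>?Q\<^esub>" by blast
  qed (auto simp: c z a M.a_ac)
  then have Q: "Module.module R ?Q"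
    by (intro moduleI R.is_cring)
      (auto simp: c a s smult_l_distr smult_r_distr smult_assoc1)
  obtain S where S: "finite S" "S \<subseteq> carrier M" "(\<lambda>H. submodule H R M) hull S = carrier M"
    using M by (auto simp: fg_module_def)
  show "fg_module R ?Q"
    using fg_image[OF module_axioms Q hom c S] .
qed

lemma ex_copy:
  fixes M :: "('a, 'b) module" and \<iota> :: "'a \<Rightarrow> 'u"
  assumes M: "fg_module R M" and U: "module_universe R \<iota>"
  shows "\<exists>(M' :: ('a, 'u) module) f. fg_module R M' \<and> f \<in> mod_iso R M M'"
proof -
  from M interpret Module.module R M by (simp add: fg_module_def)
  have inf: "infinite (UNIV :: 'u set)" and R: "carrier R \<lesssim> (UNIV :: 'u set)"
    using U by (auto simp: module_universe_def lepoll_def)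
  have small: "\<exists>N. submodule N R M \<and> S \<subseteq> N \<and> N \<lesssim> (UNIV :: 'u set)"
    if "finite S" "S \<subseteq> carrier M" for S
    using that
  proof (induction S rule: finite_induct)
    case empty
    have "submodule {\<zero>\<^bsub>M\<^esub>} R M" by (rule submoduleI) auto
    moreover have "{\<zero>\<^bsub>M\<^esub>} \<lesssim> (UNIV :: 'u set)" by (simp add: lepoll_def)
    ultimately show ?case by blast
  next
    case (insert s S)
    then obtain N where N: "submodule N R M" "S \<subseteq> N" "N \<lesssim> (UNIV :: 'u set)" by auto
    note E = submoduleE[OF N(1)]
    have s: "s \<in> carrier M" using insert by auto
    have zN: "\<zero>\<^bsub>M\<^esub> \<in> N" using E(1,2) E(4)[OF R.zero_closed] smult_l_null by fastforce
    let ?h = "\<lambda>(r, n). r \<odot>\<^bsub>M\<^esub> s \<oplus>\<^bsub>M\<^esub> n"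
    let ?K = "?h ` (carrier R \<times> N)"
    have sub: "submodule ?K R M"
    proof (rule submoduleI)
      show "?K \<subseteq> carrier M" using E(1) s by auto
      show "\<zero>\<^bsub>M\<^esub> \<in> ?K" using zN s by (intro image_eqI[of _ _ "(\<zero>\<^bsub>R\<^esub>, \<zero>\<^bsub>M\<^esub>)"]) auto
    next
      fix x assume "x \<in> ?K"
      then obtain r n where x: "r \<in> carrier R" "n \<in> N" "x = r \<odot>\<^bsub>M\<^esub> s \<oplus>\<^bsub>M\<^esub> n" by auto
      then have "n \<in> carrier M" using E(1) by auto
      with x s have "\<ominus>\<^bsub>M\<^esub> x = ?h (\<ominus>\<^bsub>R\<^esub> r, \<ominus>\<^bsub>M\<^esub> n)"
        by (simp add: smult_l_minus M.minus_add)
      with x E(3) show "\<ominus>\<^bsub>M\<^esub> x \<in> ?K" by blast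
    next
      fix x y assume "x \<in> ?K" "y \<in> ?K"
      then obtain r n r' n' where x: "r \<in> carrier R" "n \<in> N" "x = r \<odot>\<^bsub>M\<^esub> s \<oplus>\<^bsub>M\<^esub> n"
        and y: "r' \<in> carrier R" "n' \<in> N" "y = r' \<odot>\<^bsub>M\<^esub> s \<oplus>\<^bsub>M\<^esub> n'" by auto
      then have "n \<in> carrier M" "n' \<in> carrier M" using E(1) by auto
      with x y s have "x \<oplus>\<^bsub>M\<^esub> y = ?h (r \<oplus>\<^bsub>R\<^esub> r', n \<oplus>\<^bsub>M\<^esub> n')"
        by (simp add: smult_l_distr M.a_ac)
      with x y E(5) show "x \<oplus>\<^bsub>M\<^esub> y \<in> ?K" by blast
    next
      fix a x assume a: "a \<in> carrier R" and "x \<in> ?K"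
      then obtain r n where x: "r \<in> carrier R" "n \<in> N" "x = r \<odot>\<^bsub>M\<^esub> s \<oplus>\<^bsub>M\<^esub> n" by auto
      then have "n \<in> carrier M" using E(1) by auto
      with a x s have "a \<odot>\<^bsub>M\<^esub> x = ?h (a \<otimes>\<^bsub>R\<^esub> r, a \<odot>\<^bsub>M\<^esub> n)"
        by (simp add: smult_r_distr smult_assoc1)
      with a x E(4) show "a \<odot>\<^bsub>M\<^esub> x \<in> ?K" by blast
    qed
    have "s \<in> ?K" using zN s by (intro image_eqI[of _ _ "(\<one>\<^bsub>R\<^esub>, \<zero>\<^bsub>M\<^esub>)"]) auto
    moreover have "n \<in> ?K" if "n \<in> N" for n
      using that s E(1) by (intro image_eqI[of _ _ "(\<zero>\<^bsub>R\<^esub>, n)"]) auto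
    ultimately have "insert s S \<subseteq> ?K" using N(2) by blast
    moreover have "?K \<lesssim> (UNIV :: 'u set)"
    proof -
      have "?K \<lesssim> carrier R \<times> N" by (rule image_lepoll)
      also have "\<dots> \<lesssim> (UNIV :: 'u set) \<times> (UNIV :: 'u set)" by (intro times_lepoll_mono R N(3))
      also have "\<dots> \<approx> (UNIV :: 'u set)" 
        using card_of_Times_same_infinite[OF inf] by (simp only: eqpoll_iff_card_of_ordIso)
      finally show ?thesis .
    qed
    ultimately show ?case using sub by blast
  qed
  obtain S where S: "finite S" "S \<subseteq> carrier M" "(\<lambda>H. submodule H R M) hull S = carrier M"
    using M by (auto simp: fg_module_def)
  then obtain N where N: "submodule N R M" "S \<subseteq> N" "N \<lesssim> (UNIV :: 'u set)"
    using small by blast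
  then have "carrier M \<subseteq> N" using S(3) hull_minimal[of S N "\<lambda>H. submodule H R M"] by simp
  then have "carrier M \<lesssim> (UNIV :: 'u set)"
    using N(3) subset_imp_lepoll lepoll_trans by blast
  then obtain f :: "'b \<Rightarrow> 'u" where "inj_on f (carrier M)" by (auto simp: lepoll_def)
  then show ?thesis
    using transport_module_fg[OF M] transport_module_iso(1)[OF module_axioms] by blast
qed

text \<open>
  Finite generation of \<open>N\<close> is not required separately: for Noetherian \<open>R\<close>, submodules of
  finitely generated modules are finitely generated.
\<close>

definition closure_operation ::
  "('a, 'r) ring_scheme \<Rightarrow> (('a, 'u) module \<Rightarrow> 'u set \<Rightarrow> 'u set) \<Rightarrow> bool" where
  "closure_operation R cl \<longleftrightarrow>
     (\<forall>M N. fg_module R M \<and> submodule N R M \<longrightarrow>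
        submodule (cl M N) R M \<and> N \<subseteq> cl M N \<and> cl M (cl M N) = cl M N \<and>
        (\<forall>N'. submodule N' R M \<and> N \<subseteq> N' \<longrightarrow> cl M N \<subseteq> cl M N'))"

definition ideal_closure ::
  "('a, 'r) ring_scheme \<Rightarrow> ('a \<Rightarrow> 'u) \<Rightarrow> (('a, 'u) module \<Rightarrow> 'u set \<Rightarrow> 'u set) \<Rightarrow> 'a set \<Rightarrow> 'a set"
where
  "ideal_closure R \<iota> cl I =
     {r \<in> carrier R. \<iota> r \<in> cl (transport_module \<iota> (regular_module R)) (\<iota> ` I)}"

definition functorial ::
  "('a, 'r) ring_scheme \<Rightarrow> (('a, 'u) module \<Rightarrow> 'u set \<Rightarrow> 'u set) \<Rightarrow> bool" where
  "functorial R cl \<longleftrightarrow>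
     (\<forall>M N W f. fg_module R M \<and> submodule N R M \<and> fg_module R W \<and> f \<in> mod_hom R M W \<longrightarrow>
        f ` cl M N \<subseteq> cl W (f ` N))"

text \<open>
  The elements of \<open>quot_module M N\<close> are sets over \<open>'u\<close>, so \<open>M/N\<close> is replaced by its copies in \<open>'u\<close>,
  which exist by \<open>quot_module_fg\<close> and \<open>ex_copy\<close>.
\<close>

definition semi_residual ::
  "('a, 'r) ring_scheme \<Rightarrow> (('a, 'u) module \<Rightarrow> 'u set \<Rightarrow> 'u set) \<Rightarrow> bool" where
  "semi_residual R cl \<longleftrightarrow>
     (\<forall>M N. fg_module R M \<and> submodule N R M \<and> cl M N = N \<longrightarrow>
        (\<forall>Q \<phi>. fg_module R Q \<and> \<phi> \<in> mod_iso R (quot_module M N) Q \<longrightarrow>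
           cl Q {\<zero>\<^bsub>Q\<^esub>} = {\<zero>\<^bsub>Q\<^esub>}))"

definition faithful ::
  "('a, 'r) ring_scheme \<Rightarrow> 'a set \<Rightarrow> ('a \<Rightarrow> 'u) \<Rightarrow> (('a, 'u) module \<Rightarrow> 'u set \<Rightarrow> 'u set) \<Rightarrow> bool" where
  "faithful R m \<iota> cl \<longleftrightarrow> ideal_closure R \<iota> cl m = m"

definition generalized_colon_capturing ::
  "('a, 'r) ring_scheme \<Rightarrow> 'a set \<Rightarrow> (('a, 'u) module \<Rightarrow> 'u set \<Rightarrow> 'u set) \<Rightarrow> bool" where
  "generalized_colon_capturing R m cl \<longleftrightarrow>
     (\<forall>xs y M f v. partial_sop R m (xs @ [y]) \<and> fg_module R M \<longrightarrow>
        (let J = genideal R (set xs); Q = quot_module (regular_module R) J in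
           f \<in> mod_hom R M Q \<and> f ` carrier M = carrier Q \<and> v \<in> carrier M \<and> f v = J +>\<^bsub>R\<^esub> y \<longrightarrow>
           cl M {r \<odot>\<^bsub>M\<^esub> v | r. r \<in> carrier R} \<inter> {u \<in> carrier M. f u = \<zero>\<^bsub>Q\<^esub>}
             \<subseteq> cl M {r \<odot>\<^bsub>M\<^esub> v | r. r \<in> J}))"

definition dietz_closure ::
  "('a, 'r) ring_scheme \<Rightarrow> 'a set \<Rightarrow> ('a \<Rightarrow> 'u) \<Rightarrow> (('a, 'u) module \<Rightarrow> 'u set \<Rightarrow> 'u set) \<Rightarrow> bool" where
  "dietz_closure R m \<iota> cl \<longleftrightarrow>
     closure_operation R cl \<and> functorial R cl \<and> semi_residual R cl \<and> faithful R m \<iota> cl \<and>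
     generalized_colon_capturing R m cl"

end

theory Submission
  imports Defs
begin

text \<open>
  A Dietz closure satisfies a strong form of colon-capturing: if \<open>J\<close> is generated by parameters
  that \<open>y\<close> extends, then \<open>y q \<in> (J, y x)\<^sup>c\<^sup>l\<close> implies \<open>q \<in> (J, x)\<^sup>c\<^sup>l\<close>. With \<open>y = x\<^sub>i\<^sup>t\<close> and \<open>x = x\<^sub>i\<close>
  this removes the factors \<open>x\<^sub>i\<^sup>t\<close> of \<open>(x\<^sub>1 \<dots> x\<^sub>k)\<^sup>t\<close> one at a time, while \<open>x\<^sub>i\<^sup>t\<^sup>+\<^sup>1\<close> is replaced by
  \<open>x\<^sub>i\<close> among the generators. At the end \<open>1 \<in> (x\<^sub>1, \<dots>, x\<^sub>k)\<^sup>c\<^sup>l \<subseteq> m\<^sup>c\<^sup>l\<close>, against faithfulness.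
\<close>

section \<open>Modules\<close>

lemma mod_homD:
  assumes "f \<in> mod_hom R M N"
  shows "x \<in> carrier M \<Longrightarrow> f x \<in> carrier N"
    and "x \<in> carrier M \<Longrightarrow> y \<in> carrier M \<Longrightarrow> f (x \<oplus>\<^bsub>M\<^esub> y) = f x \<oplus>\<^bsub>N\<^esub> f y"
    and "a \<in> carrier R \<Longrightarrow> x \<in> carrier M \<Longrightarrow> f (a \<odot>\<^bsub>M\<^esub> x) = a \<odot>\<^bsub>N\<^esub> f x"
  using assms by (auto simp: mod_hom_def)

lemma mod_hom_comp:
  assumes "f \<in> mod_hom R M N" "g \<in> mod_hom R N P"
  shows "g \<circ> f \<in> mod_hom R M P"
  using assms by (simp add: mod_hom_def Pi_def)

lemma mod_hom_zero:
  assumes "Module.module R M" "Module.module R N" "f \<in> mod_hom R M N"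
  shows "f \<zero>\<^bsub>M\<^esub> = \<zero>\<^bsub>N\<^esub>"
proof -
  interpret M: Module.module R M by fact
  interpret N: Module.module R N by fact
  show ?thesis
    using mod_homD(3)[OF assms(3), of "\<zero>\<^bsub>R\<^esub>" "\<zero>\<^bsub>M\<^esub>"] mod_homD(1)[OF assms(3), of "\<zero>\<^bsub>M\<^esub>"] by simp
qed

lemma mod_hom_minus:
  assumes "Module.module R M" "Module.module R N" "f \<in> mod_hom R M N" "x \<in> carrier M"
  shows "f (\<ominus>\<^bsub>M\<^esub> x) = \<ominus>\<^bsub>N\<^esub> f x"
proof -
  interpret M: Module.module R M by fact
  interpret N: Module.module R N by fact
  have "f (\<ominus>\<^bsub>M\<^esub> x) \<oplus>\<^bsub>N\<^esub> f x = \<zero>\<^bsub>N\<^esub>"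
    using mod_homD(2)[OF assms(3), of "\<ominus>\<^bsub>M\<^esub> x" x] mod_hom_zero[OF assms(1-3)] assms(4)
    by (simp add: M.M.l_neg)
  then show ?thesis
    using mod_homD(1)[OF assms(3)] assms(4) by (simp add: N.M.minus_equality)
qed

lemma mod_iso_inv:
  assumes "Module.module R M" "f \<in> mod_iso R M N"
  shows "inv_into (carrier M) f \<in> mod_hom R N M"
    and "x \<in> carrier M \<Longrightarrow> inv_into (carrier M) f (f x) = x"
    and "y \<in> carrier N \<Longrightarrow> f (inv_into (carrier M) f y) = y"
proof -
  interpret M: Module.module R M by fact
  let ?g = "inv_into (carrier M) f"
  have f: "f \<in> mod_hom R M N" and inj: "inj_on f (carrier M)" and im: "f ` carrier M = carrier N"
    using assms(2) by (auto simp: mod_iso_def bij_betw_def)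
  show gf: "?g (f x) = x" if "x \<in> carrier M" for x using that inj by simp
  show "f (?g y) = y" if "y \<in> carrier N" for y using that im by (simp add: f_inv_into_f)
  show "?g \<in> mod_hom R N M"
    unfolding mod_hom_def im[symmetric]
    by (auto simp: gf simp flip: mod_homD(2,3)[OF f])
qed

lemma submodule_image:
  assumes "Module.module R M" "Module.module R N" "f \<in> mod_hom R M N" "submodule H R M"
  shows "submodule (f ` H) R N"
proof -
  interpret M: Module.module R M by fact
  interpret N: Module.module R N by fact
  note f = mod_homD[OF assms(3)] and E = M.submoduleE[OF assms(4)]
  have H: "x \<in> carrier M" if "x \<in> H" for x using that E(1) by auto
  obtain h where "h \<in> H" using E(2) by blast
  then have z: "\<zero>\<^bsub>M\<^esub> \<in> H" using E(4)[of "\<zero>\<^bsub>R\<^esub>" h] H by simp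
  show ?thesis
  proof (rule N.submoduleI)
    show "\<zero>\<^bsub>N\<^esub> \<in> f ` H" using z mod_hom_zero[OF assms(1-3)] by (metis imageI)
    show "\<ominus>\<^bsub>N\<^esub> a \<in> f ` H" if "a \<in> f ` H" for a
      using that H E(3) mod_hom_minus[OF assms(1-3)] by (auto simp flip: mod_hom_minus[OF assms(1-3)])
    show "a \<oplus>\<^bsub>N\<^esub> b \<in> f ` H" if "a \<in> f ` H" "b \<in> f ` H" for a b
      using that H E(5) by (auto simp flip: f(2))
    show "r \<odot>\<^bsub>N\<^esub> a \<in> f ` H" if "r \<in> carrier R" "a \<in> f ` H" for r a
      using that H E(4) by (auto simp flip: f(3))
  qed (use f H in auto)
qed

text \<open>Allows inclusions to be checked on generators: the elements that \<open>f\<close> sends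
  into \<open>H\<close> contain everything they generate. It also shows later that closures of
  ideals are ideals.\<close>

lemma submodule_preimage:
  assumes "Module.module R M" "Module.module R N" "f \<in> mod_hom R M N" "submodule H R N"
  shows "submodule {x \<in> carrier M. f x \<in> H} R M"
proof -
  interpret M: Module.module R M by fact
  interpret N: Module.module R N by fact
  note f = mod_homD[OF assms(3)] and E = N.submoduleE[OF assms(4)]
  obtain h where "h \<in> H" using E(2) by blast
  then have z: "\<zero>\<^bsub>N\<^esub> \<in> H" using E(4)[of "\<zero>\<^bsub>R\<^esub>" h] E(1) by auto
  show ?thesis
    by (rule M.submoduleI) (use f E z mod_hom_zero[OF assms(1-3)] mod_hom_minus[OF assms(1-3)] in auto)
qed

lemma submodule_zero: "Module.module R M \<Longrightarrow> submodule {\<zero>\<^bsub>M\<^esub>} R M"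
proof -
  assume "Module.module R M"
  then interpret Module.module R M .
  show ?thesis by (rule submoduleI) auto
qed

text \<open>The closure axioms speak of submodules only, so \<open>R v\<close> has to be known as
  one before its closure can be used.\<close>

lemma submodule_cyclic:
  assumes "Module.module R M" "v \<in> carrier M"
  shows "submodule {r \<odot>\<^bsub>M\<^esub> v | r. r \<in> carrier R} R M"
proof -
  interpret Module.module R M by fact
  show ?thesis
  proof (rule submoduleI)
    show "\<zero>\<^bsub>M\<^esub> \<in> {r \<odot>\<^bsub>M\<^esub> v | r. r \<in> carrier R}"
      using assms(2) smult_l_null R.zero_closed by (metis (mono_tags, lifting) mem_Collect_eq)
    show "\<ominus>\<^bsub>M\<^esub> a \<in> {r \<odot>\<^bsub>M\<^esub> v | r. r \<in> carrier R}" if "a \<in> {r \<odot>\<^bsub>M\<^esub> v | r. r \<in> carrier R}" for a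
      using that assms(2) by (auto simp flip: smult_l_minus)
    show "a \<oplus>\<^bsub>M\<^esub> b \<in> {r \<odot>\<^bsub>M\<^esub> v | r. r \<in> carrier R}"
      if "a \<in> {r \<odot>\<^bsub>M\<^esub> v | r. r \<in> carrier R}" "b \<in> {r \<odot>\<^bsub>M\<^esub> v | r. r \<in> carrier R}" for a b
      using that assms(2) by (auto simp flip: smult_l_distr)
    show "s \<odot>\<^bsub>M\<^esub> a \<in> {r \<odot>\<^bsub>M\<^esub> v | r. r \<in> carrier R}"
      if "s \<in> carrier R" "a \<in> {r \<odot>\<^bsub>M\<^esub> v | r. r \<in> carrier R}" for s a
      using that assms(2) by (auto simp flip: smult_assoc1)
  qed (use assms(2) in auto)
qed

text \<open>Complements \<open>quot_module_fg\<close>, where the projection is shown to be linear.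
  The zero of the quotient is the coset \<open>N\<close> itself and \<open>x\<close> lies in its own
  coset, which identifies the kernel.\<close>

lemma quot_module_proj:
  assumes "Module.module R M" "submodule N R M"
  shows "(\<lambda>x. N +>\<^bsub>M\<^esub> x) ` carrier M = carrier (quot_module M N)"
    and "x \<in> carrier M \<Longrightarrow> N +>\<^bsub>M\<^esub> x = \<zero>\<^bsub>quot_module M N\<^esub> \<longleftrightarrow> x \<in> N"
proof -
  interpret Module.module R M by fact
  interpret N: submodule N R M by fact
  interpret A: abelian_subgroup N M
    by (intro abelian_subgroupI3 additive_subgroup.intro N.subgroup_axioms abelian_group_axioms)
  show "(\<lambda>x. N +>\<^bsub>M\<^esub> x) ` carrier M = carrier (quot_module M N)"
    by (auto simp: quot_module_def A_RCOSETS_def' a_r_coset_def')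
  show "N +>\<^bsub>M\<^esub> x = \<zero>\<^bsub>quot_module M N\<^esub> \<longleftrightarrow> x \<in> N" if "x \<in> carrier M"
    using that A.a_rcos_self[of x] A.a_rcos_const[of x] by (auto simp: quot_module_def)
qed

section \<open>Direct sums of two modules\<close>

text \<open>The external direct sum, to which generalized colon-capturing will be applied. Its
  elements are pairs, so closures are taken in a copy over \<open>'u\<close> supplied by
  \<open>ex_copy\<close>.\<close>

definition prod_module :: "('a, 'b) module \<Rightarrow> ('a, 'c) module \<Rightarrow> ('a, 'b \<times> 'c) module" where
  "prod_module M N = \<lparr>carrier = carrier M \<times> carrier N, monoid.mult = undefined, one = undefined,
     ring.zero = (\<zero>\<^bsub>M\<^esub>, \<zero>\<^bsub>N\<^esub>), add = (\<lambda>p q. (fst p \<oplus>\<^bsub>M\<^esub> fst q, snd p \<oplus>\<^bsub>N\<^esub> snd q)),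
     smult = (\<lambda>a p. (a \<odot>\<^bsub>M\<^esub> fst p, a \<odot>\<^bsub>N\<^esub> snd p))\<rparr>"

lemma prod_module_simps [simp]:
  "carrier (prod_module M N) = carrier M \<times> carrier N"
  "\<zero>\<^bsub>prod_module M N\<^esub> = (\<zero>\<^bsub>M\<^esub>, \<zero>\<^bsub>N\<^esub>)"
  "p \<oplus>\<^bsub>prod_module M N\<^esub> q = (fst p \<oplus>\<^bsub>M\<^esub> fst q, snd p \<oplus>\<^bsub>N\<^esub> snd q)"
  "a \<odot>\<^bsub>prod_module M N\<^esub> p = (a \<odot>\<^bsub>M\<^esub> fst p, a \<odot>\<^bsub>N\<^esub> snd p)"
  by (simp_all add: prod_module_def)

lemma prod_module_module:
  assumes "Module.module R M" "Module.module R N"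
  shows "Module.module R (prod_module M N)"
proof -
  interpret M: Module.module R M by fact
  interpret N: Module.module R N by fact
  have "abelian_group (prod_module M N)"
  proof (rule abelian_groupI)
    fix p assume "p \<in> carrier (prod_module M N)"
    then show "\<exists>q\<in>carrier (prod_module M N). q \<oplus>\<^bsub>prod_module M N\<^esub> p = \<zero>\<^bsub>prod_module M N\<^esub>"
      by (intro bexI[of _ "(\<ominus>\<^bsub>M\<^esub> fst p, \<ominus>\<^bsub>N\<^esub> snd p)"]) (auto simp: M.M.l_neg N.M.l_neg)
  qed (auto simp: M.M.a_ac N.M.a_ac)
  then show ?thesis
    by (intro moduleI M.R.is_cring)
      (auto simp: M.smult_l_distr M.smult_r_distr M.smult_assoc1
        N.smult_l_distr N.smult_r_distr N.smult_assoc1)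
qed

lemma prod_module_homs:
  assumes "Module.module R M" "Module.module R N"
  shows "fst \<in> mod_hom R (prod_module M N) M" "snd \<in> mod_hom R (prod_module M N) N"
    and "(\<lambda>x. (x, \<zero>\<^bsub>N\<^esub>)) \<in> mod_hom R M (prod_module M N)"
    and "(\<lambda>y. (\<zero>\<^bsub>M\<^esub>, y)) \<in> mod_hom R N (prod_module M N)"
proof -
  interpret M: Module.module R M by fact
  interpret N: Module.module R N by fact
  show "fst \<in> mod_hom R (prod_module M N) M" "snd \<in> mod_hom R (prod_module M N) N"
    "(\<lambda>x. (x, \<zero>\<^bsub>N\<^esub>)) \<in> mod_hom R M (prod_module M N)"
    "(\<lambda>y. (\<zero>\<^bsub>M\<^esub>, y)) \<in> mod_hom R N (prod_module M N)"
    by (auto simp: mod_hom_def)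
qed

text \<open>Generators of the summands, embedded by the two inclusions, suffice. A submodule
  containing them has preimages under the inclusions that contain \<open>S\<close> and
  \<open>T\<close>, hence everything, and every pair is a sum of \<open>(x, 0)\<close> and
  \<open>(0, y)\<close>.\<close>

lemma prod_module_fg:
  assumes "fg_module R M" "fg_module R N"
  shows "fg_module R (prod_module M N)"
proof -
  let ?P = "prod_module M N" and ?i = "\<lambda>x. (x, \<zero>\<^bsub>N\<^esub>)" and ?j = "\<lambda>y. (\<zero>\<^bsub>M\<^esub>, y)"
  obtain S T where M: "Module.module R M" and N: "Module.module R N"
    and S: "finite S" "S \<subseteq> carrier M" "(\<lambda>H. submodule H R M) hull S = carrier M"
    and T: "finite T" "T \<subseteq> carrier N" "(\<lambda>H. submodule H R N) hull T = carrier N"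
    using assms by (auto simp: fg_module_def)
  interpret M: Module.module R M by fact
  interpret N: Module.module R N by fact
  interpret P: Module.module R ?P by (rule prod_module_module[OF M N])
  note h = prod_module_homs[OF M N]
  have "carrier ?P \<subseteq> H" if H: "submodule H R ?P" and sub: "?i ` S \<union> ?j ` T \<subseteq> H" for H
  proof -
    have "carrier M \<subseteq> {x \<in> carrier M. ?i x \<in> H}"
      unfolding S(3)[symmetric] using S sub
      by (intro hull_minimal submodule_preimage[OF M P.module_axioms h(3) H, folded S(3)])
        (auto simp: S(3))
    moreover have "carrier N \<subseteq> {x \<in> carrier N. ?j x \<in> H}"
      unfolding T(3)[symmetric] using T sub
      by (intro hull_minimal submodule_preimage[OF N P.module_axioms h(4) H, folded T(3)])
        (auto simp: T(3))
    ultimately show ?thesis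
      using P.submoduleE(5)[OF H, of "?i _" "?j _"] by fastforce
  qed
  then have "(\<lambda>H. submodule H R ?P) hull (?i ` S \<union> ?j ` T) = carrier ?P"
    using P.carrier_is_submodule S(2) T(2) unfolding hull_def
    by (intro equalityI Inter_lower Inter_greatest) auto
  with S T show ?thesis
    unfolding fg_module_def
    by (intro conjI P.module_axioms exI[of _ "?i ` S \<union> ?j ` T"]) auto
qed

section \<open>The ring as a module over itself\<close>

lemma regular_module_simps [simp]:
  "carrier (regular_module R) = carrier R"
  "\<zero>\<^bsub>regular_module R\<^esub> = \<zero>\<^bsub>R\<^esub>"
  "x \<oplus>\<^bsub>regular_module R\<^esub> y = x \<oplus>\<^bsub>R\<^esub> y"
  "a \<odot>\<^bsub>regular_module R\<^esub> x = a \<otimes>\<^bsub>R\<^esub> x"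
  "N +>\<^bsub>regular_module R\<^esub> x = N +>\<^bsub>R\<^esub> x"
  by (simp_all add: regular_module_def a_r_coset_def')

context cring
begin

lemma regular_module_module: "Module.module R (regular_module R)"
proof -
  have "abelian_group (regular_module R)"
    by (rule abelian_groupI) (auto simp: a_ac intro!: bexI[of _ "\<ominus> _"] l_neg)
  then show ?thesis
    by (intro moduleI is_cring) (auto simp: l_distr r_distr m_assoc)
qed

text \<open>Commutativity makes scalar multiplication two-sided, and negatives come from
  multiplication by \<open>-1\<close>. The equivalence carries facts on submodules over to
  ideals.\<close>

lemma submodule_regular_iff: "submodule I R (regular_module R) \<longleftrightarrow> ideal I R"
proof -
  interpret M: Module.module R "regular_module R" by (rule regular_module_module)
  show ?thesis
  proof
    assume I: "submodule I R (regular_module R)"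
    note E = M.submoduleE[OF I]
    have sub: "I \<subseteq> carrier R" using E(1) by simp
    show "ideal I R"
    proof (rule idealI)
      show "subgroup I (add_monoid R)"
      proof (rule add.subgroupI)
        show "\<ominus> a \<in> I" if "a \<in> I" for a
          using E(4)[of "\<ominus> \<one>" a] that sub by (auto simp: l_minus)
      qed (use E sub in auto)
      show "x \<otimes> a \<in> I" if "a \<in> I" "x \<in> carrier R" for a x
        using E(4)[of x a] that by simp
      then show "a \<otimes> x \<in> I" if "a \<in> I" "x \<in> carrier R" for a x
        using that sub m_comm[of a x] by auto
    qed (rule ring_axioms)
  next
    assume "ideal I R"
    then interpret ideal I R .
    show "submodule I R (regular_module R)"
    proof (rule M.submoduleI)
      show "\<ominus>\<^bsub>regular_module R\<^esub> a \<in> I" if "a \<in> I" for a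
        using that M.smult_l_minus[of \<one> a] I_l_closed[of a "\<ominus> \<one>"] by simp
    qed (auto simp: I_l_closed)
  qed
qed

lemma regular_module_fg: "fg_module R (regular_module R)"
proof -
  interpret M: Module.module R "regular_module R" by (rule regular_module_module)
  \<comment> \<open>The hull is an intersection of ideals containing \<open>1\<close>, and each of
    these is all of \<open>R\<close>.\<close>
  have "(\<lambda>H. submodule H R (regular_module R)) hull {\<one>} = carrier R"
    unfolding hull_def submodule_regular_iff
    using oneideal ideal.one_imp_carrier by (intro equalityI Inter_lower Inter_greatest) auto
  then show ?thesis
    unfolding fg_module_def by (intro conjI M.module_axioms exI[of _ "{\<one>}"]) auto
qed

end

section \<open>Closures of ideals\<close>

lemma closure_operationD:
  assumes "closure_operation R cl" "fg_module R M" "submodule N R M"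
  shows "submodule (cl M N) R M" "N \<subseteq> cl M N" "cl M (cl M N) = cl M N"
    and "submodule N' R M \<Longrightarrow> N \<subseteq> N' \<Longrightarrow> cl M N \<subseteq> cl M N'"
  using assms by (auto simp: closure_operation_def)

text \<open>Functoriality only reaches the closure of the image of \<open>N\<close>. That image is a
  submodule, so monotonicity enlarges it to \<open>N'\<close>.\<close>

lemma functorial_image_subset:
  assumes "closure_operation R cl" "functorial R cl" "fg_module R M" "fg_module R W"
    and "f \<in> mod_hom R M W" "submodule N R M" "submodule N' R W" "f ` N \<subseteq> N'"
  shows "f ` cl M N \<subseteq> cl W N'"
proof -
  have "submodule (f ` N) R W"
    using submodule_image[of R M W f N] assms by (auto simp: fg_module_def)
  then have "cl W (f ` N) \<subseteq> cl W N'"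
    using closure_operationD(4)[of R cl W "f ` N" N'] assms by blast
  moreover have "f ` cl M N \<subseteq> cl W (f ` N)"
    using assms unfolding functorial_def by blast
  ultimately show ?thesis by blast
qed

lemma (in cring) transport_regular:
  assumes "inj_on \<iota> (carrier R)"
  shows "fg_module R (transport_module \<iota> (regular_module R))"
    and "\<iota> \<in> mod_iso R (regular_module R) (transport_module \<iota> (regular_module R))"
    and "\<iota> \<in> mod_hom R (regular_module R) (transport_module \<iota> (regular_module R))"
    and "ideal I R \<Longrightarrow> submodule (\<iota> ` I) R (transport_module \<iota> (regular_module R))"
proof -
  let ?S = "regular_module R" and ?T = "transport_module \<iota> (regular_module R)"
  have inj: "inj_on \<iota> (carrier ?S)" using assms by simp
  show T: "fg_module R ?T" by (rule transport_module_fg[OF regular_module_fg inj])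
  show iso: "\<iota> \<in> mod_iso R ?S ?T" by (rule transport_module_iso(1)[OF regular_module_module inj])
  then show hom: "\<iota> \<in> mod_hom R ?S ?T" by (simp add: mod_iso_def)
  show "submodule (\<iota> ` I) R ?T" if "ideal I R"
    using that T submodule_image[OF regular_module_module _ hom]
    by (auto simp: fg_module_def submodule_regular_iff)
qed

text \<open>All three facts are pulled back along \<open>\<iota>\<close> from the closure axioms in
  the copy of \<open>R\<close>.\<close>

lemma (in cring) ideal_closureD:
  assumes "closure_operation R cl" "module_universe R \<iota>" "ideal I R"
  shows "ideal (ideal_closure R \<iota> cl I) R" "I \<subseteq> ideal_closure R \<iota> cl I"
    and "ideal I' R \<Longrightarrow> I \<subseteq> I' \<Longrightarrow> ideal_closure R \<iota> cl I \<subseteq> ideal_closure R \<iota> cl I'"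
proof -
  let ?S = "regular_module R" and ?T = "transport_module \<iota> (regular_module R)"
  have "inj_on \<iota> (carrier R)" using assms(2) by (simp add: module_universe_def)
  note T = transport_regular[OF this]
  note c = closure_operationD[OF assms(1) T(1) T(4)[OF assms(3)]]
  interpret I: ideal I R by fact
  show "ideal (ideal_closure R \<iota> cl I) R"
    using submodule_preimage[OF regular_module_module _ T(3) c(1)] T(1)
    by (simp add: fg_module_def submodule_regular_iff ideal_closure_def)
  show "I \<subseteq> ideal_closure R \<iota> cl I" using c(2) I.a_subset by (auto simp: ideal_closure_def)
  show "ideal_closure R \<iota> cl I \<subseteq> ideal_closure R \<iota> cl I'" if "ideal I' R" "I \<subseteq> I'"
    using c(4)[OF T(4)[OF that(1)]] that(2) by (auto simp: ideal_closure_def)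
qed

text \<open>The closure is computed in the copy of \<open>R\<close>, while \<open>g\<close> starts
  at \<open>R\<close> itself. Functoriality is therefore applied to \<open>g\<close> composed with
  the inverse of \<open>\<iota>\<close>.\<close>

lemma (in cring) map_ideal_closure_subset:
  assumes "closure_operation R cl" "functorial R cl" "module_universe R \<iota>" "fg_module R M"
    and "g \<in> mod_hom R (regular_module R) M" "ideal I R" "submodule N R M" "g ` I \<subseteq> N"
  shows "g ` ideal_closure R \<iota> cl I \<subseteq> cl M N"
proof -
  let ?S = "regular_module R" and ?T = "transport_module \<iota> (regular_module R)"
  have inj: "inj_on \<iota> (carrier R)" using assms(3) by (simp add: module_universe_def)
  note T = transport_regular[OF inj]
  interpret I: ideal I R by fact
  let ?h = "g \<circ> inv_into (carrier R) \<iota>"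
  have "?h \<in> mod_hom R ?T M"
    using mod_hom_comp[OF mod_iso_inv(1)[OF regular_module_module T(2)] assms(5)] by simp
  moreover have "?h ` \<iota> ` I \<subseteq> N"
    using assms(8) I.a_subset inj by (auto simp: inv_into_f_f subset_iff)
  ultimately have "?h ` cl ?T (\<iota> ` I) \<subseteq> cl M N"
    using functorial_image_subset[OF assms(1,2) T(1) assms(4) _ T(4)[OF assms(6)] assms(7)] by blast
  then show ?thesis using inj by (auto simp: ideal_closure_def image_subset_iff)
qed

text \<open>\<open>Q\<close> is a copy in \<open>'u\<close> of \<open>R\<close> modulo the closure
  of \<open>I\<close>. By idempotence that closure is a closed submodule, which is the premise of
  semi-residuality.\<close>

lemma (in cring) ex_closed_quotient:
  fixes \<iota> :: "'a \<Rightarrow> 'u" and cl :: "('a, 'u) module \<Rightarrow> 'u set \<Rightarrow> 'u set"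
  assumes "closure_operation R cl" "semi_residual R cl" "module_universe R \<iota>" "ideal I R"
  obtains Q :: "('a, 'u) module" and \<pi> where "fg_module R Q" "\<pi> \<in> mod_hom R (regular_module R) Q"
    and "\<And>r. r \<in> carrier R \<Longrightarrow> \<pi> r = \<zero>\<^bsub>Q\<^esub> \<longleftrightarrow> r \<in> ideal_closure R \<iota> cl I" "cl Q {\<zero>\<^bsub>Q\<^esub>} = {\<zero>\<^bsub>Q\<^esub>}"
proof -
  let ?T = "transport_module \<iota> (regular_module R)"
  have "inj_on \<iota> (carrier R)" using assms(3) by (simp add: module_universe_def)
  note T = transport_regular[OF this]
  let ?N = "cl ?T (\<iota> ` I)"
  note c = closure_operationD[OF assms(1) T(1) T(4)[OF assms(4)]]
  let ?Q = "quot_module ?T ?N" and ?p = "\<lambda>x. ?N +>\<^bsub>?T\<^esub> x"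
  note q = quot_module_fg[OF T(1) c(1)]
  have mods: "Module.module R ?T" "Module.module R ?Q" using T(1) q(1) by (auto simp: fg_module_def)
  obtain Q :: "('a, 'u) module" and \<phi> where Q: "fg_module R Q" "\<phi> \<in> mod_iso R ?Q Q"
    using ex_copy[OF q(1) assms(3)] by blast
  have \<phi>: "\<phi> \<in> mod_hom R ?Q Q" "inj_on \<phi> (carrier ?Q)"
    using Q(2) by (auto simp: mod_iso_def bij_betw_def)
  interpret Q': Module.module R ?Q by fact
  have "(\<phi> \<circ> ?p \<circ> \<iota>) r = \<zero>\<^bsub>Q\<^esub> \<longleftrightarrow> r \<in> ideal_closure R \<iota> cl I" if r: "r \<in> carrier R" for r
  proof -
    have \<iota>r: "\<iota> r \<in> carrier ?T" using mod_homD(1)[OF T(3)] r by simp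
    then have "?p (\<iota> r) \<in> carrier ?Q" using mod_homD(1)[OF q(2)] by simp
    \<comment> \<open>Injectivity of \<open>\<phi>\<close> reduces vanishing in \<open>Q\<close> to
      vanishing of a coset.\<close>
    then have "\<phi> (?p (\<iota> r)) = \<phi> \<zero>\<^bsub>?Q\<^esub> \<longleftrightarrow> ?p (\<iota> r) = \<zero>\<^bsub>?Q\<^esub>"
      using \<phi>(2) by (auto simp: inj_on_eq_iff)
    moreover have "\<phi> \<zero>\<^bsub>?Q\<^esub> = \<zero>\<^bsub>Q\<^esub>"
      using mod_hom_zero[OF mods(2) _ \<phi>(1)] Q(1) by (simp add: fg_module_def)
    ultimately show ?thesis
      using quot_module_proj(2)[OF mods(1) c(1) \<iota>r] r by (simp add: ideal_closure_def)
  qed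
  moreover have "cl Q {\<zero>\<^bsub>Q\<^esub>} = {\<zero>\<^bsub>Q\<^esub>}"
    using assms(2) T(1) c(1,3) Q unfolding semi_residual_def by blast
  moreover have "\<phi> \<circ> ?p \<circ> \<iota> \<in> mod_hom R (regular_module R) Q"
    using mod_hom_comp[OF mod_hom_comp[OF T(3) q(2)] \<phi>(1)] by (simp add: comp_assoc)
  ultimately show thesis using Q(1) that by blast
qed

section \<open>Strong colon-capturing\<close>

lemma generalized_colon_capturingD:
  assumes "generalized_colon_capturing R m cl" "partial_sop R m (xs @ [y])" "fg_module R M"
    and "f \<in> mod_hom R M (quot_module (regular_module R) (genideal R (set xs)))"
    and "f ` carrier M = carrier (quot_module (regular_module R) (genideal R (set xs)))"
    and "v \<in> carrier M" "f v = genideal R (set xs) +>\<^bsub>R\<^esub> y"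
    and "u \<in> cl M {r \<odot>\<^bsub>M\<^esub> v | r. r \<in> carrier R}" "u \<in> carrier M"
    and "f u = \<zero>\<^bsub>quot_module (regular_module R) (genideal R (set xs))\<^esub>"
  shows "u \<in> cl M {r \<odot>\<^bsub>M\<^esub> v | r. r \<in> genideal R (set xs)}"
  using assms(1)[unfolded generalized_colon_capturing_def Let_def, rule_format, of xs y M f v] assms(2-)
  by blast

text \<open>
  Generalized colon-capturing is applied to \<open>M = R/J \<times> R/N\<close> with \<open>N\<close> the closure of \<open>(J, x)\<close>,
  to \<open>v = (y, 1)\<close> and to the first projection. The map \<open>r \<mapsto> (r, 0)\<close> sends \<open>y x\<close> to \<open>x v\<close>, so
  \<open>(y q, 0)\<close> lies in the closure of \<open>R v\<close>, and so does \<open>(0, q) = q v - (y q, 0)\<close>. As \<open>J v = 0\<close>,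
  \<open>(0, q)\<close> lies in the closure of \<open>0\<close>, and zero is closed in \<open>R/N\<close> by semi-residuality.
\<close>

lemma dietz_strong_colon_capturing:
  fixes \<iota> :: "'a \<Rightarrow> 'u" and cl :: "('a, 'u) module \<Rightarrow> 'u set \<Rightarrow> 'u set"
    and R :: "('a, 'r) ring_scheme"
  assumes "cring R" and univ: "module_universe R \<iota>" and dietz: "dietz_closure R m \<iota> cl"
    and sop: "partial_sop R m (zs @ [y])" and zs: "set zs \<subseteq> carrier R"
    and y: "y \<in> carrier R" and x: "x \<in> carrier R" and q: "q \<in> carrier R"
    and mem: "y \<otimes>\<^bsub>R\<^esub> q \<in> ideal_closure R \<iota> cl (genideal R (insert (y \<otimes>\<^bsub>R\<^esub> x) (set zs)))"
  shows "q \<in> ideal_closure R \<iota> cl (genideal R (insert x (set zs)))"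
proof -
  interpret R: cring R by fact
  let ?J = "genideal R (set zs)" and ?I = "genideal R (insert x (set zs))"
    and ?S = "regular_module R"
  have clop: "closure_operation R cl" and func: "functorial R cl" and sres: "semi_residual R cl"
    and gcc: "generalized_colon_capturing R m cl"
    using dietz by (auto simp: dietz_closure_def)
  have J: "ideal ?J R" and I: "ideal ?I R" using zs x by (auto intro!: R.genideal_ideal)
  interpret J: ideal ?J R by (rule J)
  have xI: "insert x (set zs) \<subseteq> ?I" using R.genideal_self[of "insert x (set zs)"] zs x by simp
  have JI: "?J \<subseteq> ?I" using xI by (intro R.genideal_minimal[OF I]) auto
  \<comment> \<open>\<open>Q\<close> stands for \<open>R/N\<close>, and \<open>\<pi>\<close> for the
    projection from \<open>R\<close>.\<close>
  obtain Q :: "('a, 'u) module" and \<pi> where Q: "fg_module R Q" and \<pi>: "\<pi> \<in> mod_hom R ?S Q"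
    and ker: "\<And>r. r \<in> carrier R \<Longrightarrow> \<pi> r = \<zero>\<^bsub>Q\<^esub> \<longleftrightarrow> r \<in> ideal_closure R \<iota> cl ?I"
    and Q0: "cl Q {\<zero>\<^bsub>Q\<^esub>} = {\<zero>\<^bsub>Q\<^esub>}"
    using R.ex_closed_quotient[OF clop sres univ I] by blast
  have kerI: "\<pi> r = \<zero>\<^bsub>Q\<^esub>" if "r \<in> ?I" for r
    using that ker R.ideal_closureD(2)[OF clop univ I] ideal.Icarr[OF I] by blast
  have J': "submodule ?J R ?S" using J by (simp add: R.submodule_regular_iff)
  let ?B = "quot_module ?S ?J" and ?p = "\<lambda>r. ?J +>\<^bsub>R\<^esub> r"
  have B: "fg_module R ?B" and p: "?p \<in> mod_hom R ?S ?B"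
    using quot_module_fg[OF R.regular_module_fg J'] by simp_all
  have p_im: "?p ` carrier R = carrier ?B"
    and p_ker: "\<And>r. r \<in> carrier R \<Longrightarrow> ?p r = \<zero>\<^bsub>?B\<^esub> \<longleftrightarrow> r \<in> ?J"
    using quot_module_proj[OF R.regular_module_module J'] by simp_all
  let ?P = "prod_module ?B Q"
  have P: "fg_module R ?P" by (rule prod_module_fg[OF B Q])
  \<comment> \<open>The closure accepts only modules over \<open>'u\<close>, so the sum is replaced
    by a copy \<open>M\<close>. Below, \<open>\<psi>\<close> and \<open>?\<theta>\<close> translate
    between pairs and elements of \<open>M\<close>.\<close>
  obtain M :: "('a, 'u) module" and \<psi> where M: "fg_module R M" and \<psi>: "\<psi> \<in> mod_iso R ?P M"
    using ex_copy[OF P univ] by blast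
  have mods: "Module.module R ?B" "Module.module R Q" "Module.module R ?P" "Module.module R M"
    using B Q P M by (auto simp: fg_module_def)
  interpret B: Module.module R ?B by (rule mods)
  interpret Q: Module.module R Q by (rule mods)
  interpret P: Module.module R ?P by (rule mods)
  interpret M: Module.module R M by (rule mods)
  have \<psi>h: "\<psi> \<in> mod_hom R ?P M" using \<psi> by (simp add: mod_iso_def)
  let ?\<theta> = "inv_into (carrier ?P) \<psi>"
  note \<theta> = mod_iso_inv[OF mods(3) \<psi>]
  note h = prod_module_homs[OF mods(1,2)]
  let ?f = "fst \<circ> ?\<theta>" and ?s = "snd \<circ> ?\<theta>"
  have f: "?f \<in> mod_hom R M ?B" and s: "?s \<in> mod_hom R M Q"
    using \<theta>(1) h(1,2) by (auto intro: mod_hom_comp)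
  have pc: "?p r \<in> carrier ?B" "\<pi> r \<in> carrier Q" if "r \<in> carrier R" for r
    using mod_homD(1)[OF p] mod_homD(1)[OF \<pi>] that by auto
  have pa: "?p (a \<otimes>\<^bsub>R\<^esub> r) = a \<odot>\<^bsub>?B\<^esub> ?p r" "\<pi> (a \<otimes>\<^bsub>R\<^esub> r) = a \<odot>\<^bsub>Q\<^esub> \<pi> r"
    if "a \<in> carrier R" "r \<in> carrier R" for a r
    using mod_homD(3)[OF p] mod_homD(3)[OF \<pi>] that by auto
  define v where "v = \<psi> (?p y, \<pi> \<one>\<^bsub>R\<^esub>)"
  have v: "v \<in> carrier M" using mod_homD(1)[OF \<psi>h] pc y by (simp add: v_def)
  have rv: "r \<odot>\<^bsub>M\<^esub> v = \<psi> (?p (r \<otimes>\<^bsub>R\<^esub> y), \<pi> r)" if r: "r \<in> carrier R" for r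
    using mod_homD(3)[OF \<psi>h r, of "(?p y, \<pi> \<one>\<^bsub>R\<^esub>)"] pa[OF r, of y] pa[OF r, of "\<one>\<^bsub>R\<^esub>"] pc r y
    by (simp add: v_def)
  let ?Rv = "{r \<odot>\<^bsub>M\<^esub> v | r. r \<in> carrier R}"
  have Rv: "submodule ?Rv R M" by (rule submodule_cyclic[OF mods(4) v])
  note Rvc = closure_operationD[OF clop M Rv]
  define g where "g = \<psi> \<circ> ((\<lambda>b. (b, \<zero>\<^bsub>Q\<^esub>)) \<circ> ?p)"
  have g: "g \<in> mod_hom R ?S M"
    unfolding g_def by (intro mod_hom_comp[OF _ \<psi>h] mod_hom_comp[OF p h(3)])
  have \<psi>0: "\<psi> (\<zero>\<^bsub>?B\<^esub>, \<zero>\<^bsub>Q\<^esub>) = \<zero>\<^bsub>M\<^esub>"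
    using mod_hom_zero[OF mods(3,4) \<psi>h] by simp
  have gJ: "g r = \<zero>\<^bsub>M\<^esub>" if "r \<in> ?J" for r
    using that p_ker[of r] J.Icarr[OF that] by (simp add: g_def \<psi>0)
  \<comment> \<open>By \<open>rv\<close>, \<open>x v\<close> is the pair of the classes of
    \<open>x y\<close> and \<open>x\<close>. The second one vanishes in \<open>Q\<close> because
    \<open>x\<close> lies in \<open>?I\<close>.\<close>
  have "g (y \<otimes>\<^bsub>R\<^esub> x) = x \<odot>\<^bsub>M\<^esub> v"
    using rv[OF x] kerI[of x] xI x y by (simp add: g_def R.m_comm)
  \<comment> \<open>Testing generators is enough, since the preimage of \<open>R v\<close> under
    \<open>g\<close> is an ideal. The elements of \<open>zs\<close> already vanish in
    \<open>R/J\<close>.\<close>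
  then have "insert (y \<otimes>\<^bsub>R\<^esub> x) (set zs) \<subseteq> {r \<in> carrier ?S. g r \<in> ?Rv}"
    using x y zs gJ R.genideal_self[OF zs] M.submoduleE(1,2)[OF Rv] M.smult_l_null[OF v, symmetric]
    by auto
  then have "genideal R (insert (y \<otimes>\<^bsub>R\<^esub> x) (set zs)) \<subseteq> {r \<in> carrier ?S. g r \<in> ?Rv}"
    using submodule_preimage[OF R.regular_module_module mods(4) g Rv]
    by (intro R.genideal_minimal) (auto simp: R.submodule_regular_iff)
  then have "g ` genideal R (insert (y \<otimes>\<^bsub>R\<^esub> x) (set zs)) \<subseteq> ?Rv" by blast
  moreover have "ideal (genideal R (insert (y \<otimes>\<^bsub>R\<^esub> x) (set zs))) R"
    using zs x y by (intro R.genideal_ideal) simp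
  ultimately have gq: "g (y \<otimes>\<^bsub>R\<^esub> q) \<in> cl M ?Rv"
    using R.map_ideal_closure_subset[OF clop func univ M g _ Rv] mem by blast
  have split: "q \<odot>\<^bsub>M\<^esub> v = g (y \<otimes>\<^bsub>R\<^esub> q) \<oplus>\<^bsub>M\<^esub> \<psi> (\<zero>\<^bsub>?B\<^esub>, \<pi> q)"
    using rv[OF q] mod_homD(2)[OF \<psi>h, of "(?p (y \<otimes>\<^bsub>R\<^esub> q), \<zero>\<^bsub>Q\<^esub>)" "(\<zero>\<^bsub>?B\<^esub>, \<pi> q)"] pc y q
    by (simp add: g_def R.m_comm)
  let ?u = "\<psi> (\<zero>\<^bsub>?B\<^esub>, \<pi> q)"
  have u: "?u \<in> carrier M" and gc: "g (y \<otimes>\<^bsub>R\<^esub> q) \<in> carrier M"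
    using mod_homD(1)[OF \<psi>h] pc q y mod_homD(1)[OF g] by auto
  have "?u = \<ominus>\<^bsub>M\<^esub> g (y \<otimes>\<^bsub>R\<^esub> q) \<oplus>\<^bsub>M\<^esub> q \<odot>\<^bsub>M\<^esub> v"
    unfolding split using u gc by (simp add: M.M.r_neg1)
  moreover have "q \<odot>\<^bsub>M\<^esub> v \<in> cl M ?Rv" using Rvc(2) q by blast
  ultimately have uRv: "?u \<in> cl M ?Rv"
    using gq M.submoduleE(3,5)[OF Rvc(1)] by simp
  have fu: "?f ?u = \<zero>\<^bsub>?B\<^esub>" and su: "?s ?u = \<pi> q"
    using \<theta>(2)[of "(\<zero>\<^bsub>?B\<^esub>, \<pi> q)"] pc q by simp_all
  have fv: "?f v = ?p y" using \<theta>(2)[of "(?p y, \<pi> \<one>\<^bsub>R\<^esub>)"] pc y by (simp add: v_def)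
  have f_im: "?f ` carrier M = carrier ?B"
  proof
    show "?f ` carrier M \<subseteq> carrier ?B" using mod_homD(1)[OF f] by blast
    show "carrier ?B \<subseteq> ?f ` carrier M"
    proof
      fix b assume b: "b \<in> carrier ?B"
      then have "?f (\<psi> (b, \<zero>\<^bsub>Q\<^esub>)) = b" "\<psi> (b, \<zero>\<^bsub>Q\<^esub>) \<in> carrier M"
        using \<theta>(2)[of "(b, \<zero>\<^bsub>Q\<^esub>)"] mod_homD(1)[OF \<psi>h, of "(b, \<zero>\<^bsub>Q\<^esub>)"] by simp_all
      then show "b \<in> ?f ` carrier M" by (metis imageI)
    qed
  qed
  have "?u \<in> cl M {r \<odot>\<^bsub>M\<^esub> v | r. r \<in> ?J}"
    by (rule generalized_colon_capturingD[OF gcc sop M f f_im v fv uRv u fu])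
  \<comment> \<open>For \<open>r\<close> in \<open>J\<close> the pair \<open>r v\<close> consists of
    the classes of \<open>r y\<close> and \<open>r\<close>: the first vanishes in
    \<open>R/J\<close>, the second in \<open>Q\<close> because \<open>J\<close> lies in
    \<open>?I\<close>.\<close>
  moreover have "{r \<odot>\<^bsub>M\<^esub> v | r. r \<in> ?J} = {\<zero>\<^bsub>M\<^esub>}"
  proof -
    have Jv: "r \<odot>\<^bsub>M\<^esub> v = \<zero>\<^bsub>M\<^esub>" if r: "r \<in> ?J" for r
    proof -
      have rc: "r \<in> carrier R" using J.Icarr[OF r] .
      have "?p (r \<otimes>\<^bsub>R\<^esub> y) = \<zero>\<^bsub>?B\<^esub>" using p_ker J.I_r_closed[OF r y] rc y by simp
      moreover have "\<pi> r = \<zero>\<^bsub>Q\<^esub>" using kerI JI r by blast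
      ultimately show ?thesis using rv[OF rc] by (simp add: \<psi>0)
    qed
    then have "{r \<odot>\<^bsub>M\<^esub> v | r. r \<in> ?J} \<subseteq> {\<zero>\<^bsub>M\<^esub>}" by blast
    moreover have "\<zero>\<^bsub>M\<^esub> \<in> {r \<odot>\<^bsub>M\<^esub> v | r. r \<in> ?J}"
      using Jv[OF J.zero_closed] J.zero_closed by (metis (mono_tags, lifting) mem_Collect_eq)
    ultimately show ?thesis by blast
  qed
  ultimately have u0: "?u \<in> cl M {\<zero>\<^bsub>M\<^esub>}" by (rule subst[rotated])
  \<comment> \<open>The second projection moves the question from \<open>M\<close> to
    \<open>Q\<close>, where zero is known to be closed.\<close>
  have "?s ` cl M {\<zero>\<^bsub>M\<^esub>} \<subseteq> cl Q {\<zero>\<^bsub>Q\<^esub>}"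
  proof (rule functorial_image_subset[OF clop func M Q s])
    show "?s ` {\<zero>\<^bsub>M\<^esub>} \<subseteq> {\<zero>\<^bsub>Q\<^esub>}" using mod_hom_zero[OF mods(4,2) s] by simp
  qed (rule submodule_zero[OF mods(4)] submodule_zero[OF mods(2)])+
  then have "?s ?u \<in> {\<zero>\<^bsub>Q\<^esub>}" using imageI[OF u0, of ?s] Q0 by blast
  then have "\<pi> q = \<zero>\<^bsub>Q\<^esub>" using su by simp
  then show ?thesis using ker q by blast
qed

section \<open>Powers of parameters\<close>

context cring
begin

text \<open>Replaces the binomial expansion when \<open>c = 1\<close>, which makes radicals closed
  under addition. Splitting off one factor \<open>a + b\<close> turns \<open>c\<close> into
  \<open>a c\<close> and \<open>b c\<close>, each of which needs one exponent less; the cofactor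
  \<open>c\<close> is carried along for this induction.\<close>

lemma add_pow_mult_mem_ideal:
  fixes p q :: nat
  assumes "ideal I R" "a \<in> carrier R" "b \<in> carrier R"
  shows "c \<in> carrier R \<Longrightarrow> a [^] p \<otimes> c \<in> I \<Longrightarrow> b [^] q \<otimes> c \<in> I \<Longrightarrow> (a \<oplus> b) [^] (p + q) \<otimes> c \<in> I"
proof (induction "p + q" arbitrary: p q c)
  case 0
  then show ?case by simp
next
  case (Suc n)
  interpret I: ideal I R by fact
  note ab = assms(2,3)
  show ?case
  \<comment> \<open>A zero exponent puts \<open>c\<close> itself into \<open>I\<close>.\<close>
  proof (cases "p = 0 \<or> q = 0")
    case True
    then have "c \<in> I" using Suc.prems by auto
    then show ?thesis using ab by (auto intro: I.I_l_closed)
  next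
    case False
    then obtain p' q' where pq: "p = Suc p'" "q = Suc q'" by (meson not0_implies_Suc)
    have "(a \<oplus> b) [^] (p' + q) \<otimes> (a \<otimes> c) \<in> I"
    proof (rule Suc.hyps(1))
      show "a [^] p' \<otimes> (a \<otimes> c) \<in> I" using Suc.prems pq ab by (simp add: m_assoc)
      show "b [^] q \<otimes> (a \<otimes> c) \<in> I"
        using I.I_l_closed[OF Suc.prems(3) ab(1)] ab Suc.prems(1) by (simp add: m_lcomm)
    qed (use Suc.hyps(2) pq ab Suc.prems(1) in auto)
    moreover have "(a \<oplus> b) [^] (p + q') \<otimes> (b \<otimes> c) \<in> I"
    proof (rule Suc.hyps(1))
      show "b [^] q' \<otimes> (b \<otimes> c) \<in> I" using Suc.prems pq ab by (simp add: m_assoc)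
      show "a [^] p \<otimes> (b \<otimes> c) \<in> I"
        using I.I_l_closed[OF Suc.prems(2) ab(2)] ab Suc.prems(1) by (simp add: m_lcomm)
    qed (use Suc.hyps(2) pq ab Suc.prems(1) in auto)
    ultimately have "(a \<oplus> b) [^] (p' + q) \<otimes> (a \<otimes> c) \<oplus> (a \<oplus> b) [^] (p + q') \<otimes> (b \<otimes> c) \<in> I"
      by (rule I.a_closed)
    moreover have "(a \<oplus> b) [^] (p + q) \<otimes> c
        = (a \<oplus> b) [^] (p' + q) \<otimes> (a \<otimes> c) \<oplus> (a \<oplus> b) [^] (p + q') \<otimes> (b \<otimes> c)"
    proof -
      have "(a \<oplus> b) [^] (p + q) \<otimes> c = (a \<oplus> b) [^] (p' + q) \<otimes> ((a \<oplus> b) \<otimes> c)"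
        using ab Suc.prems(1) pq by (simp add: m_assoc)
      also have "\<dots> = (a \<oplus> b) [^] (p' + q) \<otimes> (a \<otimes> c) \<oplus> (a \<oplus> b) [^] (p' + q) \<otimes> (b \<otimes> c)"
        using ab Suc.prems(1) by (simp add: l_distr r_distr)
      finally show ?thesis by (simp add: pq)
    qed
    ultimately show ?thesis by simp
  qed
qed

lemma subset_radical:
  assumes "I \<subseteq> carrier R"
  shows "I \<subseteq> radical R I"
proof
  fix a assume "a \<in> I"
  then have "a \<in> carrier R" "a [^] (1::nat) \<in> I" using assms by auto
  then show "a \<in> radical R I" unfolding radical_def by blast
qed

lemma radical_ideal:
  assumes "ideal I R"
  shows "ideal (radical R I) R"
proof -
  interpret I: ideal I R by fact
  have mult: "x \<otimes> a \<in> radical R I" if a: "a \<in> radical R I" and x: "x \<in> carrier R" for a x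
  proof -
    obtain n :: nat where n: "a \<in> carrier R" "a [^] n \<in> I" using a by (auto simp: radical_def)
    then have "(x \<otimes> a) [^] n \<in> I" using x by (simp add: nat_pow_distrib I.I_l_closed)
    then show ?thesis using x n(1) by (auto simp: radical_def)
  qed
  show ?thesis
  proof (rule idealI)
    show "subgroup (radical R I) (add_monoid R)"
    proof (rule add.subgroupI)
      show "radical R I \<noteq> {}" using subset_radical[OF I.a_subset] I.zero_closed by blast
      show "\<ominus> a \<in> radical R I" if "a \<in> radical R I" for a
        using mult[OF that, of "\<ominus> \<one>"] that by (auto simp: radical_def l_minus)
      show "a \<oplus> b \<in> radical R I" if ab: "a \<in> radical R I" "b \<in> radical R I" for a b
      proof -
        obtain p q :: nat where "a \<in> carrier R" "a [^] p \<in> I" "b \<in> carrier R" "b [^] q \<in> I"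
          using ab by (auto simp: radical_def)
        then have "a \<oplus> b \<in> carrier R" "(a \<oplus> b) [^] (p + q) \<in> I"
          using add_pow_mult_mem_ideal[OF assms, of a b \<one> p q] by simp_all
        then show ?thesis unfolding radical_def by blast
      qed
    qed (auto simp: radical_def)
    show "x \<otimes> a \<in> radical R I" if "a \<in> radical R I" "x \<in> carrier R" for a x
      by (rule mult) fact+
    then show "a \<otimes> x \<in> radical R I" if "a \<in> radical R I" "x \<in> carrier R" for a x
      using that m_comm[of a x] by (auto simp: radical_def)
  qed (rule ring_axioms)
qed

text \<open>The exponents multiply.\<close>

lemma radical_subset_radical:
  assumes "I \<subseteq> radical R J"
  shows "radical R I \<subseteq> radical R J"
proof
  fix a assume "a \<in> radical R I"
  then obtain n :: nat where a: "a \<in> carrier R" "a [^] n \<in> radical R J"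
    using assms by (auto simp: radical_def)
  then obtain k :: nat where "a [^] (n * k) \<in> J" by (auto simp: radical_def nat_pow_pow)
  with a(1) show "a \<in> radical R J" by (auto simp: radical_def)
qed

text \<open>Each of the two ideals lies in the radical of the other, so both have radical
  \<open>m\<close>. Equal length preserves the dimension condition.\<close>

lemma system_of_parameters_cong:
  assumes sop: "system_of_parameters R m xs" and "length ys = length xs"
    and ys: "set ys \<subseteq> genideal R (set xs)" and xs: "set xs \<subseteq> radical R (genideal R (set ys))"
  shows "system_of_parameters R m ys"
proof -
  have rad: "radical R (genideal R (set xs)) = m" using sop by (simp add: system_of_parameters_def)
  have xsc: "set xs \<subseteq> carrier R" using xs by (auto simp: radical_def)
  have I: "ideal (genideal R (set xs)) R" by (rule genideal_ideal[OF xsc])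
  have Ic: "genideal R (set xs) \<subseteq> carrier R" using ideal.Icarr[OF I] by blast
  then have J: "ideal (genideal R (set ys)) R" using ys by (intro genideal_ideal) blast
  have "genideal R (set ys) \<subseteq> radical R (genideal R (set xs))"
    using genideal_minimal[OF I ys] subset_radical[OF Ic] by blast
  moreover have "genideal R (set xs) \<subseteq> radical R (genideal R (set ys))"
    by (rule genideal_minimal[OF radical_ideal[OF J] xs])
  ultimately have "radical R (genideal R (set ys)) = m"
    using radical_subset_radical rad by blast
  moreover have "set ys \<subseteq> m" using ys subset_radical[OF Ic] rad by blast
  ultimately show ?thesis using sop assms(2) by (simp add: system_of_parameters_def)
qed

text \<open>Positive powers generate an ideal with the same radical, and order does not affect it.
  The power of \<open>b\<close> goes last, the place of the new parameter in generalized
  colon-capturing.\<close>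

lemma partial_sop_powers:
  fixes k n :: nat
  assumes "partial_sop R m (xs @ [b] @ zs)" "set xs \<union> {b} \<union> set zs \<subseteq> carrier R"
    and "m \<subseteq> carrier R" and "k > 0" "n > 0"
  shows "partial_sop R m ((map (\<lambda>x. x [^] k) xs @ zs) @ [b [^] n])"
proof -
  obtain ys where ys: "system_of_parameters R m ((xs @ [b] @ zs) @ ys)"
    using assms(1) by (auto simp: partial_sop_def)
  let ?A = "set ((xs @ [b] @ zs) @ ys)"
    and ?B = "set (((map (\<lambda>x. x [^] k) xs @ zs) @ [b [^] n]) @ ys)"
  have c: "?A \<subseteq> carrier R" using ys assms(3) by (auto simp: system_of_parameters_def)
  then have c': "?B \<subseteq> carrier R" by auto
  interpret I: ideal "genideal R ?A" R by (rule genideal_ideal[OF c])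
  \<comment> \<open>A positive exponent leaves one factor \<open>x\<close>, which lies in the
    ideal.\<close>
  have pow: "x [^] i \<in> genideal R ?A" if x: "x \<in> ?A" and "i > 0" for x and i :: nat
  proof -
    obtain j where j: "i = Suc j" using \<open>i > 0\<close> by (cases i) auto
    have "x \<in> genideal R ?A" using genideal_self[OF c] x by blast
    moreover have "x [^] j \<in> carrier R" using c x by (intro nat_pow_closed) blast
    ultimately show ?thesis unfolding j nat_pow_Suc by (rule I.I_l_closed)
  qed
  have root: "x \<in> radical R (genideal R ?B)" if "x \<in> carrier R" "x [^] i \<in> ?B" for x and i :: nat
  proof -
    have "x [^] i \<in> genideal R ?B" using genideal_self[OF c'] that(2) by blast
    then show ?thesis using that(1) unfolding radical_def by blast
  qed
  have "system_of_parameters R m (((map (\<lambda>x. x [^] k) xs @ zs) @ [b [^] n]) @ ys)"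
  proof (rule system_of_parameters_cong[OF ys])
    show "?B \<subseteq> genideal R ?A" using genideal_self[OF c] pow assms(4,5) by auto
    \<comment> \<open>The exponents \<open>k\<close> and \<open>n\<close> serve \<open>xs\<close>
      and \<open>b\<close>; \<open>1\<close> serves the unchanged entries of \<open>zs\<close> and
      \<open>ys\<close>.\<close>
    show "?A \<subseteq> radical R (genideal R ?B)" 
      using c root[of _ k] root[of _ n] root[of _ 1] by auto
  qed simp
  then show ?thesis unfolding partial_sop_def by blast
qed

end

section \<open>Removing the factors of the product one at a time\<close>

text \<open>Induction from the end of the list: \<open>zs\<close> collects the parameters whose
  exponent has already dropped to \<open>1\<close>, and the product runs over those still to be
  treated.\<close>

lemma dietz_one_mem_ideal_closure:
  fixes \<iota> :: "'a \<Rightarrow> 'u" and cl :: "('a, 'u) module \<Rightarrow> 'u set \<Rightarrow> 'u set"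
    and R :: "('a, 'r) ring_scheme" and t :: nat
  assumes "cring R" and univ: "module_universe R \<iota>" and dietz: "dietz_closure R m \<iota> cl"
    and m: "m \<subseteq> carrier R" and t: "t > 0"
  shows "\<lbrakk>partial_sop R m (xs @ zs); set xs \<union> set zs \<subseteq> carrier R;
      (\<Otimes>\<^bsub>R\<^esub>i\<in>{..<length xs}. xs ! i) [^]\<^bsub>R\<^esub> t
        \<in> ideal_closure R \<iota> cl (genideal R ((\<lambda>x. x [^]\<^bsub>R\<^esub> (t + 1)) ` set xs \<union> set zs))\<rbrakk>
    \<Longrightarrow> \<one>\<^bsub>R\<^esub> \<in> ideal_closure R \<iota> cl (genideal R (set xs \<union> set zs))"
proof (induction xs arbitrary: zs rule: rev_induct)
  case Nil
  interpret R: cring R by fact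
  \<comment> \<open>The empty product is \<open>1\<close>, so the hypothesis is the claim.\<close>
  show ?case using Nil by simp
next
  case (snoc b xs)
  interpret R: cring R by fact
  have clop: "closure_operation R cl" using dietz by (simp add: dietz_closure_def)
  have c: "set xs \<subseteq> carrier R" "b \<in> carrier R" "set zs \<subseteq> carrier R" using snoc.prems(2) by auto
  let ?p = "\<Otimes>\<^bsub>R\<^esub>i\<in>{..<length xs}. xs ! i"
  let ?P = "\<lambda>n x. x [^]\<^bsub>R\<^esub> (n::nat)"
  have nth: "xs ! i \<in> carrier R" if "i < length xs" for i using that c by auto
  then have pc: "?p \<in> carrier R" by (intro R.finprod_closed) auto
  have "(\<Otimes>\<^bsub>R\<^esub>i\<in>{..<length (xs @ [b])}. (xs @ [b]) ! i)
      = b \<otimes>\<^bsub>R\<^esub> (\<Otimes>\<^bsub>R\<^esub>i\<in>{..<length xs}. (xs @ [b]) ! i)"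
    using nth c by (simp add: lessThan_Suc nth_append Pi_def)
  also have "(\<Otimes>\<^bsub>R\<^esub>i\<in>{..<length xs}. (xs @ [b]) ! i) = ?p"
    using nth by (intro R.finprod_cong') (auto simp: nth_append)
  finally have prod: "(\<Otimes>\<^bsub>R\<^esub>i\<in>{..<length (xs @ [b])}. (xs @ [b]) ! i) [^]\<^bsub>R\<^esub> t
      = b [^]\<^bsub>R\<^esub> t \<otimes>\<^bsub>R\<^esub> ?p [^]\<^bsub>R\<^esub> t"
    using c pc by (simp add: R.nat_pow_distrib)
  let ?ws = "map (?P (t + 1)) xs @ zs"
  have ws: "set ?ws \<subseteq> carrier R" using c by auto
  \<comment> \<open>The parameter to be cancelled is \<open>b^t\<close>; \<open>t > 0\<close> keeps
    it a parameter.\<close>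
  have sop: "partial_sop R m (?ws @ [b [^]\<^bsub>R\<^esub> t])"
    using R.partial_sop_powers[of m xs b zs "t + 1" t] snoc.prems(1) c m t by simp
  have "?p [^]\<^bsub>R\<^esub> t \<in> ideal_closure R \<iota> cl (genideal R (insert b (set ?ws)))"
  proof (rule dietz_strong_colon_capturing[OF \<open>cring R\<close> univ dietz sop ws])
    \<comment> \<open>The generator \<open>b^(t+1)\<close> is read as the product \<open>y x\<close>
      with \<open>y = b^t\<close> and \<open>x = b\<close>.\<close>
    have "insert (b [^]\<^bsub>R\<^esub> t \<otimes>\<^bsub>R\<^esub> b) (set ?ws)
        = (\<lambda>x. x [^]\<^bsub>R\<^esub> (t + 1)) ` set (xs @ [b]) \<union> set zs"
      using c by auto
    then show "b [^]\<^bsub>R\<^esub> t \<otimes>\<^bsub>R\<^esub> ?p [^]\<^bsub>R\<^esub> t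
        \<in> ideal_closure R \<iota> cl (genideal R (insert (b [^]\<^bsub>R\<^esub> t \<otimes>\<^bsub>R\<^esub> b) (set ?ws)))"
      using snoc.prems(3) by (simp only: prod)
  qed (use c pc in auto)
  moreover have "insert b (set ?ws) = ?P (t + 1) ` set xs \<union> set (b # zs)" by auto
  ultimately have "?p [^]\<^bsub>R\<^esub> t
      \<in> ideal_closure R \<iota> cl (genideal R (?P (t + 1) ` set xs \<union> set (b # zs)))"
    by simp
  \<comment> \<open>The reduced \<open>b\<close> joins \<open>zs\<close> at the front, so
    \<open>xs @ b # zs\<close> is the original list.\<close>
  then show ?case
    using snoc.IH[of "b # zs"] snoc.prems(1,2) by simp
qed

theorem theorem6p1:
  fixes R :: "('a, 'r) ring_scheme" and m :: "'a set" and \<iota> :: "'a \<Rightarrow> 'u"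
    and cl :: "('a, 'u) module \<Rightarrow> 'u set \<Rightarrow> 'u set" and xs :: "'a list"
  assumes "local_domain R m"
    and "module_universe R \<iota>"
    and "partial_sop R m xs"
    and "closure_operation R cl"
    and "\<exists>t::nat. (\<Otimes>\<^bsub>R\<^esub>i\<in>{..<length xs}. xs ! i) [^]\<^bsub>R\<^esub> t
           \<in> ideal_closure R \<iota> cl (genideal R {x [^]\<^bsub>R\<^esub> (t + 1) | x. x \<in> set xs})"
  shows "\<not> dietz_closure R m \<iota> cl"
proof
  assume dietz: "dietz_closure R m \<iota> cl"
  interpret local_domain R m by fact
  have m: "ideal m R" "m \<subseteq> carrier R" using maximalideal_axioms a_subset
    by (auto simp: maximalideal_def)
  have xm: "set xs \<subseteq> m" using assms(3) by (auto simp: partial_sop_def system_of_parameters_def)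
  then have xc: "set xs \<subseteq> carrier R" using m(2) by blast
  obtain t :: nat where t: "(\<Otimes>\<^bsub>R\<^esub>i\<in>{..<length xs}. xs ! i) [^]\<^bsub>R\<^esub> t
      \<in> ideal_closure R \<iota> cl (genideal R {x [^]\<^bsub>R\<^esub> (t + 1) | x. x \<in> set xs})"
    using assms(5) by blast
  have "\<one>\<^bsub>R\<^esub> \<in> ideal_closure R \<iota> cl (genideal R (set xs))"
  \<comment> \<open>For \<open>t = 0\<close> the power of the product is \<open>1\<close> and the
    generators are the parameters themselves. Cancelling \<open>b^t\<close> requires a positive
    exponent.\<close>
  proof (cases "t = 0")
    case True
    have "{x [^]\<^bsub>R\<^esub> (1::nat) | x. x \<in> set xs} = set xs" using xc by force
    with True t show ?thesis by simp
  next
    case False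
    have "{x [^]\<^bsub>R\<^esub> (t + 1) | x. x \<in> set xs} = (\<lambda>x. x [^]\<^bsub>R\<^esub> (t + 1)) ` set xs" by blast
    with False t show ?thesis
      using dietz_one_mem_ideal_closure[OF is_cring assms(2) dietz m(2), of t xs "[]"] assms(3) xc by simp
  qed
  \<comment> \<open>The parameters lie in \<open>m\<close>, so monotonicity and faithfulness would
    put \<open>1\<close> into \<open>m\<close>.\<close>
  also have "\<dots> \<subseteq> ideal_closure R \<iota> cl m"
    using ideal_closureD(3)[OF assms(4,2) genideal_ideal[OF xc] m(1) genideal_minimal[OF m(1) xm]] .
  also have "\<dots> = m" using dietz by (simp add: dietz_closure_def faithful_def)
  finally show False using one_imp_carrier I_notcarr by blast
qed

end
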